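(* Let $n\ge1$ and let $\mathcal{A}=(A_{i,j})_{0\le i,j\le n}$ be the $(n+1)\times(n+1)$-matrix with $$A_{i,j}=\begin{cases}\binom{n-i}{j-i}\binom{n}{j}\,j!\,I(n-i,n-j),&\text{if } i\le j,\\ 0,&\text{otherwise.}\end{cases}$$ For $k=0,1,\dots,n$ let $$f_k=\bigl((-1)^kR_{n,k},\,(-1)^{k-1}R_{n-1,k-1},\,\dots,\,R_{n-k,0},\,0,\dots,0\bigr)^t,$$ that is, $f_k$ is the column vector with coordinates indexed by $j=0,1,\dots,n$ whose $j$-th coordinate is $(-1)^{k-j}R_{n-j,k-j}$ for $j\le k$ and $0$ for $j>k$. Then $f_0,f_1,\dots,f_n$ are eigenvectors of $\mathcal{A}$ with eigenvalues $A_{0,0},A_{1,1},\dots,A_{n,n}$ respectively.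
   Context: For non-negative integers $i,j$, $I(i,j)$ is the number of partial injections (injective maps defined on a possibly empty subset) from $\{1,\dots,i\}$ to $\{1,\dots,j\}$, i.e. $I(i,j)=\sum_{k=0}^{\min(i,j)}\binom{i}{k}\binom{j}{k}k!$. For $0\le k\le m$, $R_{m,k}=\binom{m}{k}^2k!$ is the number of partial injective maps from $\{1,\dots,m\}$ to itself whose domain has cardinality $k$. *)

theory Defs
  imports "Jordan_Normal_Form.Char_Poly"
begin

definition partial_injections :: "'a set \<Rightarrow> 'b set \<Rightarrow> ('a \<rightharpoonup> 'b) set" where
  "partial_injections A B = {f. dom f \<subseteq> A \<and> ran f \<subseteq> B \<and> inj_on f (dom f)}"

definition I_count :: "nat \<Rightarrow> nat \<Rightarrow> nat" where
  "I_count i j = card (partial_injections {1..i} {1..j})"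

definition R_count :: "nat \<Rightarrow> nat \<Rightarrow> nat" where
  "R_count m k = (m choose k)\<^sup>2 * fact k"

definition A_mat :: "nat \<Rightarrow> 'a::field_char_0 mat" where
  "A_mat n = mat (n + 1) (n + 1) (\<lambda>(i, j).
     if i \<le> j
     then of_nat (((n - i) choose (j - i)) * (n choose j) * fact j * I_count (n - i) (n - j))
     else 0)"

definition f_vec :: "nat \<Rightarrow> nat \<Rightarrow> 'a::field_char_0 vec" where
  "f_vec n k = vec (n + 1) (\<lambda>j.
     if j \<le> k then (- 1) ^ (k - j) * of_nat (R_count (n - j) (k - j)) else 0)"

text \<open>The remaining facts confirm that the closed formula for \<open>I_count\<close> and the
  combinatorial description of \<open>R_count\<close> agree with the definitions above.\<close>

lemma prod_diff_eq_choose: "prod ((-) m) {0..<k} = (m choose k) * fact k" for m k :: nat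
proof (induction k)
  case (Suc k)
  have "(m choose k) * (m - k) = (m choose Suc k) * Suc k"
    by (metis binomial_absorb_comp binomial_absorption mult.commute)
  with Suc show ?case
    by (simp add: algebra_simps)
qed simp

lemma card_partial_injections_dom:
  assumes "finite D" "finite B"
  shows "card {f. dom f = D \<and> ran f \<subseteq> B \<and> inj_on f D} = (card B choose card D) * fact (card D)"
proof -
  let ?F = "{g \<in> D \<rightarrow>\<^sub>E B. inj_on g D}"
  have "bij_betw (\<lambda>g x. if x \<in> D then Some (g x) else None) ?F
      {f. dom f = D \<and> ran f \<subseteq> B \<and> inj_on f D}"
  proof (rule bij_betw_byWitness[where f' = "\<lambda>f. restrict (\<lambda>x. the (f x)) D"])
    show "\<forall>g\<in>?F. restrict (\<lambda>x. the (if x \<in> D then Some (g x) else None)) D = g"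
      by (auto simp: fun_eq_iff PiE_def extensional_def)
    show "\<forall>f\<in>{f. dom f = D \<and> ran f \<subseteq> B \<and> inj_on f D}.
        (\<lambda>x. if x \<in> D then Some (restrict (\<lambda>x. the (f x)) D x) else None) = f"
      by (auto simp: fun_eq_iff domIff)
    show "(\<lambda>g x. if x \<in> D then Some (g x) else None) ` ?F
        \<subseteq> {f. dom f = D \<and> ran f \<subseteq> B \<and> inj_on f D}"
      by (auto simp: dom_def ran_def inj_on_def split: if_splits)
    show "(\<lambda>f. restrict (\<lambda>x. the (f x)) D) ` {f. dom f = D \<and> ran f \<subseteq> B \<and> inj_on f D} \<subseteq> ?F"
    proof (rule image_subsetI)
      fix f assume "f \<in> {f. dom f = D \<and> ran f \<subseteq> B \<and> inj_on f D}"
      then have f: "dom f = D" "ran f \<subseteq> B" "inj_on f D" by auto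
      have some: "f x = Some (the (f x))" if "x \<in> D" for x
        using that f(1) by auto
      have "the (f x) \<in> B" if "x \<in> D" for x
        using some[OF that] f(2) by (auto intro: ranI)
      moreover have "inj_on (\<lambda>x. the (f x)) D"
        by (rule inj_onI) (metis some f(3) inj_onD)
      ultimately show "restrict (\<lambda>x. the (f x)) D \<in> ?F"
        by (simp add: inj_on_restrict_eq)
    qed
  qed
  then have "card {f. dom f = D \<and> ran f \<subseteq> B \<and> inj_on f D} = card ?F"
    by (simp add: bij_betw_same_card)
  also have "\<dots> = (card B choose card D) * fact (card D)"
    using card_inj_on_subset_funcset[OF assms subset_refl]
    by (simp add: prod_diff_eq_choose)
  finally show ?thesis .
qed

lemma finite_partial_injections:
  assumes "finite A" "finite B"
  shows "finite (partial_injections A B)"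
proof -
  have "partial_injections A B \<subseteq> (\<Union>D\<in>Pow A. {f. dom f = D \<and> ran f \<subseteq> B})"
    by (auto simp: partial_injections_def)
  moreover have "finite (\<Union>D\<in>Pow A. {f. dom f = D \<and> ran f \<subseteq> B})"
    using assms by (auto intro!: finite_set_of_finite_maps dest: finite_subset)
  ultimately show ?thesis
    by (rule finite_subset)
qed

lemma card_partial_injections_card_dom:
  assumes "finite A" "finite B"
  shows "card {f \<in> partial_injections A B. card (dom f) = k}
    = (card A choose k) * (card B choose k) * fact k"
proof -
  let ?P = "\<lambda>D. {f. dom f = D \<and> ran f \<subseteq> B \<and> inj_on f D}"
  let ?S = "{D. D \<subseteq> A \<and> card D = k}"
  have fin: "finite D" if "D \<in> ?S" for D
    using that assms(1) by (auto dest: finite_subset)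
  have "{f \<in> partial_injections A B. card (dom f) = k} = (\<Union>D\<in>?S. ?P D)"
    by (auto simp: partial_injections_def)
  also have "card \<dots> = (\<Sum>D\<in>?S. card (?P D))"
  proof (rule card_UN_disjoint)
    show "\<forall>D\<in>?S. finite (?P D)"
    proof
      fix D assume "D \<in> ?S"
      then have "finite {f. dom f = D \<and> ran f \<subseteq> B}"
        using fin assms(2) by (intro finite_set_of_finite_maps)
      then show "finite (?P D)"
        by (rule rev_finite_subset) blast
    qed
  qed (use assms(1) in auto)
  also have "\<dots> = (\<Sum>D\<in>?S. (card B choose k) * fact k)"
    using fin assms(2) by (intro sum.cong) (auto simp: card_partial_injections_dom)
  also have "\<dots> = (card A choose k) * (card B choose k) * fact k"
    using n_subsets[OF assms(1)] by simp
  finally show ?thesis .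
qed

lemma I_count_eq_sum: "I_count i j = (\<Sum>k=0..min i j. (i choose k) * (j choose k) * fact k)"
proof -
  let ?P = "partial_injections {1..i} {1..j}"
  have le: "card (dom f) \<le> i" if "f \<in> ?P" for f
    using that card_mono[of "{1..i}" "dom f"] by (auto simp: partial_injections_def)
  have "?P = (\<Union>k\<in>{0..i}. {f \<in> ?P. card (dom f) = k})"
    using le by auto
  then have "I_count i j = card (\<Union>k\<in>{0..i}. {f \<in> ?P. card (dom f) = k})"
    by (simp add: I_count_def)
  also have "\<dots> = (\<Sum>k=0..i. card {f \<in> ?P. card (dom f) = k})"
    by (rule card_UN_disjoint) (auto simp: finite_partial_injections)
  also have "\<dots> = (\<Sum>k=0..i. (i choose k) * (j choose k) * fact k)"
    by (simp add: card_partial_injections_card_dom)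
  also have "\<dots> = (\<Sum>k=0..min i j. (i choose k) * (j choose k) * fact k)"
    by (rule sum.mono_neutral_right) (auto simp: binomial_eq_0)
  finally show ?thesis .
qed

lemma R_count_eq_card:
  "R_count m k = card {f \<in> partial_injections {1..m} {1..m}. card (dom f) = k}"
  by (simp add: R_count_def card_partial_injections_card_dom power2_eq_square)

end

theory Submission
  imports Defs
begin

text \<open>The matrix is upper triangular and \<open>f_vec n k\<close> vanishes below position \<open>k\<close>, so only rows
  \<open>i \<le> k\<close> matter. There the \<open>j\<close>-dependent binomials collapse: with \<open>N = n - i\<close>, \<open>K = k - i\<close> and
  \<open>s = j - i\<close>, row \<open>i\<close> of the product is a constant times
  \[ \sum_{s \le K} (-1)^s \binom{K}{s} I(N, N - s). \]
  By inclusion-exclusion this sum counts the partial injections from \<open>N\<close> points to \<open>N\<close> points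
  whose image contains \<open>K\<close> prescribed points: the term \<open>s\<close> counts those avoiding \<open>s\<close> of the \<open>K\<close>
  points. Such a map is determined by the ordered preimages of the prescribed points,
  \<open>(N choose K) * fact K\<close> choices, and by a partial injection between the remaining \<open>N - K = n - k\<close>
  points on either side. So the sum equals \<open>(N choose K) * fact K * I(n - k, n - k)\<close>, and the
  factor \<open>I(n - k, n - k)\<close>, independent of the row, is the one that occurs in the eigenvalue.
  The vector is nonzero because its coordinate \<open>k\<close> is \<open>1\<close>.

  The lemma \<open>alternating_sum_I_count\<close> is this count, obtained by iterating the case \<open>K = 1\<close>, which
  is \<open>I_count_Suc_Suc\<close>; the lemma \<open>row_coefficient\<close> is the collapse of the binomials.\<close>

lemma falling_factorial_Suc:
  "(Suc n choose Suc k) * fact (Suc k) = Suc n * ((n choose k) * fact k)"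
proof -
  have "(Suc n choose Suc k) * fact (Suc k) = ((Suc n choose Suc k) * Suc k) * fact k"
    by (simp only: fact_Suc of_nat_id mult.assoc)
  then show ?thesis
    by (simp only: Suc_times_binomial_eq[symmetric] mult.assoc)
qed

text \<open>Split according to whether the last point of the target is in the image. If it is, it has
  \<open>Suc a\<close> possible preimages.\<close>

lemma I_count_Suc_Suc: "I_count (Suc a) (Suc b) = I_count (Suc a) b + Suc a * I_count a b"
proof -
  \<comment> \<open>A summation range that depends on the source only makes the three sums comparable.\<close>
  have I: "I_count i j = (\<Sum>k\<le>i. (i choose k) * (j choose k) * fact k)" for i j
    unfolding I_count_eq_sum
    by (rule sum.mono_neutral_left) (auto simp: binomial_eq_0)
  have "(Suc a choose Suc k) * (Suc b choose Suc k) * fact (Suc k)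
      = (Suc a choose Suc k) * (b choose Suc k) * fact (Suc k)
        + Suc a * ((a choose k) * (b choose k) * fact k)" for k
  proof -
    have "(Suc a choose Suc k) * (Suc b choose Suc k) * fact (Suc k)
        = (Suc a choose Suc k) * (b choose Suc k) * fact (Suc k)
          + ((Suc a choose Suc k) * fact (Suc k)) * (b choose k)"
      unfolding binomial_Suc_Suc[of b k] by (simp only: algebra_simps)
    then show ?thesis
      unfolding falling_factorial_Suc by (simp only: ac_simps)
  qed
  then show ?thesis
    unfolding I sum.atMost_Suc_shift sum_distrib_left
    by (simp only: sum.distrib binomial_n_0 add.assoc)
qed

text \<open>This is Pascal's rule for iterated finite differences. When \<open>g\<close> satisfies a recurrence for
  its first difference, it turns that recurrence into an induction on the order.\<close>

lemma alternating_binomial_sum_Suc: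
  fixes g :: "nat \<Rightarrow> 'a::comm_ring_1"
  shows "(\<Sum>s\<le>Suc K. (- 1) ^ s * of_nat (Suc K choose s) * g s)
    = (\<Sum>s\<le>K. (- 1) ^ s * of_nat (K choose s) * (g s - g (Suc s)))"
proof -
  have "(\<Sum>s\<le>Suc K. (- 1) ^ s * of_nat (Suc K choose s) * g s)
      = (g 0 + (\<Sum>s\<le>K. (- 1) ^ Suc s * of_nat (K choose Suc s) * g (Suc s)))
        - (\<Sum>s\<le>K. (- 1) ^ s * of_nat (K choose s) * g (Suc s))"
    unfolding sum.atMost_Suc_shift add_diff_eq[symmetric] sum_subtractf[symmetric]
    by (intro arg_cong2[where f = "(+)"] sum.cong) (simp_all add: algebra_simps)
  also have "g 0 + (\<Sum>s\<le>K. (- 1) ^ Suc s * of_nat (K choose Suc s) * g (Suc s))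
      = (\<Sum>s\<le>Suc K. (- 1) ^ s * of_nat (K choose s) * g s)"
    unfolding sum.atMost_Suc_shift by simp
  also have "\<dots> = (\<Sum>s\<le>K. (- 1) ^ s * of_nat (K choose s) * g s)"
    by (simp add: binomial_eq_0)
  finally show ?thesis
    by (simp add: sum_subtractf algebra_simps)
qed

text \<open>Both sides count the partial injections from \<open>a\<close> points to \<open>b + K\<close> points whose image
  contains \<open>K\<close> prescribed points. For \<open>a < K\<close> there are none. The induction removes one
  prescribed point, together with its preimage, at a time.\<close>

lemma alternating_sum_I_count:
  "(\<Sum>s\<le>K. (- 1) ^ s * of_nat (K choose s) * of_nat (I_count a (b + K - s)))
    = (of_nat ((a choose K) * fact K * I_count (a - K) b) :: 'a::comm_ring_1)"
proof (induction K arbitrary: a)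
  case 0
  then show ?case by simp
next
  case (Suc K)
  show ?case
  proof (cases a)
    case 0
    have "I_count 0 j = 1" for j
      by (simp add: I_count_eq_sum)
    then show ?thesis
      unfolding alternating_binomial_sum_Suc by (simp add: 0)
  next
    case (Suc a')
    have diff: "(of_nat (I_count a (b + Suc K - s)) - of_nat (I_count a (b + Suc K - Suc s)) :: 'a)
        = of_nat (Suc a') * of_nat (I_count a' (b + K - s))" if "s \<le> K" for s
    proof -
      have "b + Suc K - s = Suc (b + K - s)" "b + Suc K - Suc s = b + K - s"
        using that by auto
      then show ?thesis
        by (simp add: Suc I_count_Suc_Suc algebra_simps)
    qed
    have "(\<Sum>s\<le>Suc K. (- 1) ^ s * of_nat (Suc K choose s) * of_nat (I_count a (b + Suc K - s)))
        = (\<Sum>s\<le>K. of_nat (Suc a') *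
            ((- 1) ^ s * of_nat (K choose s) * of_nat (I_count a' (b + K - s))) :: 'a)"
      unfolding alternating_binomial_sum_Suc
      by (intro sum.cong refl, subst diff) (simp_all only: atMost_iff mult.left_commute)
    also have "\<dots> = of_nat (Suc a' * ((a' choose K) * fact K * I_count (a' - K) b))"
      unfolding sum_distrib_left[symmetric] Suc.IH by (simp only: of_nat_mult)
    also have "Suc a' * ((a' choose K) * fact K * I_count (a' - K) b)
        = (a choose Suc K) * fact (Suc K) * I_count (a - Suc K) b"
      using falling_factorial_Suc[of a' K] by (simp only: Suc mult.assoc[symmetric] diff_Suc_Suc)
    finally show ?thesis .
  qed
qed

text \<open>\<open>(n choose j) * fact j\<close> is the falling factorial \<open>n (n - 1) \<dots> (n - j + 1)\<close>; it is extended
  by the one of \<open>n - j\<close> to the one of length \<open>k\<close>.\<close>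

lemma falling_factorial_split:
  assumes "j \<le> k" "k \<le> n"
  shows "((n choose j) * fact j) * (((n - j) choose (k - j)) * fact (k - j))
    = (n choose k) * fact k"
proof -
  have "(n choose j) * ((n - j) choose (k - j)) = (n choose k) * (k choose j)"
    using choose_mult[OF assms] by simp
  moreover have "(k choose j) * fact j * fact (k - j) = fact k"
    using binomial_fact_lemma[OF assms(1)] by (simp add: ac_simps)
  ultimately show ?thesis
    by (metis (no_types, lifting) mult.assoc mult.commute)
qed

text \<open>The factor \<open>R_count (n - j) (k - j)\<close> contains the binomial \<open>(n - j) choose (k - j)\<close> twice.
  One copy completes the falling factorial of length \<open>j\<close> to length \<open>k\<close>, the other turns a choice
  of \<open>j\<close> and then \<open>k\<close> into a choice of \<open>k\<close> and then \<open>j\<close>. The only remaining dependence on \<open>j\<close> is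
  the binomial needed for inclusion-exclusion.\<close>

lemma row_coefficient:
  assumes "i \<le> j" "j \<le> k" "k \<le> n"
  shows "((n - i) choose (j - i)) * (n choose j) * fact j * R_count (n - j) (k - j)
    = (n choose k) * fact k * ((n - i) choose (k - i)) * ((k - i) choose (j - i))"
proof -
  have "((n - i) choose (j - i)) * ((n - j) choose (k - j))
      = ((n - i) choose (k - i)) * ((k - i) choose (j - i))"
    using choose_mult[of "j - i" "k - i" "n - i"] assms by simp
  moreover have "((n - i) choose (j - i)) * (n choose j) * fact j * R_count (n - j) (k - j)
      = (((n - i) choose (j - i)) * ((n - j) choose (k - j)))
        * (((n choose j) * fact j) * (((n - j) choose (k - j)) * fact (k - j)))"
    by (simp add: R_count_def power2_eq_square)
  ultimately show ?thesis
    using falling_factorial_split[OF assms(2,3)] by simp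
qed

lemma A_mat_index:
  assumes "i \<le> n" "j \<le> n"
  shows "A_mat n $$ (i, j) = (if i \<le> j
    then of_nat (((n - i) choose (j - i)) * (n choose j) * fact j * I_count (n - i) (n - j))
    else 0)"
  using assms by (simp add: A_mat_def)

lemma f_vec_index:
  assumes "j \<le> n"
  shows "f_vec n k $ j =
    (if j \<le> k then (- 1) ^ (k - j) * of_nat (R_count (n - j) (k - j)) else 0)"
  using assms by (simp add: f_vec_def)

lemma A_mat_f_vec_row:
  assumes "i \<le> n" "k \<le> n"
  shows "(\<Sum>j\<le>n. A_mat n $$ (i, j) * f_vec n k $ j)
    = (A_mat n $$ (k, k) * f_vec n k $ i :: 'a::field_char_0)"
proof -
  have "(\<Sum>j\<le>n. A_mat n $$ (i, j) * f_vec n k $ j)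
      = (\<Sum>j\<in>{i..k}. A_mat n $$ (i, j) * f_vec n k $ j :: 'a)"
    using assms by (intro sum.mono_neutral_right) (auto simp: A_mat_index f_vec_index)
  also have "\<dots> = A_mat n $$ (k, k) * f_vec n k $ i"
  proof (cases "i \<le> k")
    case False
    then show ?thesis
      using assms by (simp add: f_vec_index)
  next
    case True
    let ?K = "k - i" and ?N = "n - i"
    define C where "C = (- 1) ^ ?K * (of_nat ((n choose k) * fact k * (?N choose ?K)) :: 'a)"
    have summand: "A_mat n $$ (i, i + s) * f_vec n k $ (i + s)
        = C * ((- 1) ^ s * of_nat (?K choose s) * of_nat (I_count ?N (n - k + ?K - s)))"
      if "s \<le> ?K" for s
    proof -
      have le: "i + s \<le> k" "i \<le> i + s" "i + s \<le> n"
        using that True assms by auto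
      have sign: "(- 1) ^ (k - (i + s)) = (- 1) ^ ?K * ((- 1) ^ s :: 'a)"
      proof -
        have "?K + s = (k - (i + s)) + 2 * s"
          using that by simp
        then have "(- 1) ^ ?K * (- 1) ^ s = ((- 1) ^ ((k - (i + s)) + 2 * s) :: 'a)"
          by (simp only: power_add[symmetric])
        then show ?thesis
          by (simp only: power_add power_mult power2_eq_square) simp
      qed
      have target: "n - (i + s) = n - k + ?K - s"
        using True assms by simp
      have "A_mat n $$ (i, i + s) * f_vec n k $ (i + s)
          = ((- 1) ^ (k - (i + s)) *
            of_nat (((?N choose (i + s - i)) * (n choose (i + s)) * fact (i + s)
              * R_count (n - (i + s)) (k - (i + s))) * I_count ?N (n - (i + s))) :: 'a)"
        using le assms by (simp add: A_mat_index f_vec_index)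
      also have "\<dots> = (- 1) ^ ?K * (- 1) ^ s *
            of_nat (((n choose k) * fact k * (?N choose ?K) * (?K choose s))
              * I_count ?N (n - k + ?K - s))"
        unfolding row_coefficient[OF le(2,1) assms(2)] sign
        by (simp only: target add_diff_cancel_left' mult.assoc)
      finally show ?thesis
        by (simp add: C_def)
    qed
    have "(\<Sum>j\<in>{i..k}. A_mat n $$ (i, j) * f_vec n k $ j)
        = (\<Sum>s\<le>?K. A_mat n $$ (i, i + s) * f_vec n k $ (i + s) :: 'a)"
      by (rule sum.reindex_bij_witness[of _ "\<lambda>s. i + s" "\<lambda>j. j - i"]) (use True in auto)
    also have "\<dots> = C * of_nat ((?N choose ?K) * fact ?K * I_count (?N - ?K) (n - k))"
      unfolding alternating_sum_I_count[symmetric] sum_distrib_left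
      by (intro sum.cong refl summand) simp
    also have "\<dots> = A_mat n $$ (k, k) * f_vec n k $ i"
      using True assms
      by (simp add: C_def A_mat_index f_vec_index R_count_def power2_eq_square ac_simps)
    finally show ?thesis .
  qed
  finally show ?thesis .
qed

theorem proposition9:
  fixes n :: nat
  assumes "n \<ge> 1"
  shows "\<forall>k\<le>n. eigenvector (A_mat n :: 'a::field_char_0 mat) (f_vec n k) (A_mat n $$ (k, k))"
proof (intro allI impI)
  fix k assume k: "k \<le> n"
  let ?A = "A_mat n :: 'a mat" and ?f = "f_vec n k :: 'a vec"
  have dim: "dim_row ?A = n + 1" "dim_col ?A = n + 1" "dim_vec ?f = n + 1"
    by (simp_all add: A_mat_def f_vec_def)
  have "?f $ k = 1"
    using k by (simp add: f_vec_index R_count_def)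
  then have nonzero: "?f \<noteq> 0\<^sub>v (n + 1)"
    using k by auto
  have "?A *\<^sub>v ?f = ?A $$ (k, k) \<cdot>\<^sub>v ?f"
  proof (rule eq_vecI)
    fix i assume "i < dim_vec (?A $$ (k, k) \<cdot>\<^sub>v ?f)"
    then have i: "i \<le> n"
      by (simp add: dim)
    have "(?A *\<^sub>v ?f) $ i = (\<Sum>j = 0..<n + 1. ?A $$ (i, j) * ?f $ j)"
      using i by (simp add: dim scalar_prod_def)
    also have "{0..<n + 1} = {..n}"
      by auto
    also note A_mat_f_vec_row[OF i k]
    finally show "(?A *\<^sub>v ?f) $ i = (?A $$ (k, k) \<cdot>\<^sub>v ?f) $ i"
      using i by (simp add: dim)
  qed (simp add: dim)
  with nonzero show "eigenvector ?A ?f (?A $$ (k, k))"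
    by (simp add: eigenvector_def dim carrier_vecI)
qed

end
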